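(* Let $\ell\ge 1$, let $(\mu_{i,j})_{i,j\in\mathbb{N}}$ be real skew-symmetric bi-moments, and for $k=1,\ldots,\ell$ let $(\beta^{(k)}_j)_{j\in\mathbb{N}}$ be real numbers such that $\tau_{2n}^{(m)}\neq0$ and $\tau_{2n+1,k}^{(m)}\ne0$ for all $n,m\in\mathbb{N}$ and all $k$. Let $Q_{2n}^{(m)}$ and $Q_{2n+1,k}^{(m)}$ be the adjacent families of $\ell$-component partial-skew-orthogonal polynomials. Then for all $n,m\in\mathbb{N}$ and $k=1,\ldots,\ell$ \begin{align*} Q_{2n+1,k}^{(m)}(z)+\mathcal{E}_{n,k}^m Q_{2n}^{(m)}(z)&=z\left(Q_{2n}^{(m+1)}(z)+\mathcal{F}_{n,k}^m Q_{2n-1,k}^{(m+1)}(z)\right),\\ Q_{2n+2}^{(m)}(z)+\mathcal{G}_{n,k}^{m} Q_{2n+1,k}^{(m)}(z)&=z\left(Q_{2n+1,k}^{(m+1)}(z)+\mathcal{H}_{n,k}^m Q_{2n}^{(m+1)}(z)\right), \end{align*} where $$\mathcal{E}_{n,k}^m=\frac{\tau_{2n}^{(m)}\tau_{2n+1,k}^{(m+1)}}{\tau_{2n+1,k}^{(m)}\tau_{2n}^{(m+1)}},\quad \mathcal{F}_{n,k}^m=\frac{\tau_{2n+2}^{(m)}\tau_{2n-1,k}^{(m+1)}}{\tau_{2n+1,k}^{(m)}\tau_{2n}^{(m+1)}},\quad \mathcal{G}_{n,k}^m=\frac{\tau_{2n+1,k}^{(m)}\tau_{2n+2}^{(m+1)}}{\tau_{2n+2}^{(m)}\tau_{2n+1,k}^{(m+1)}},\quad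 \mathcal{H}_{n,k}^m=\frac{\tau_{2n+3,k}^{(m)}\tau_{2n}^{(m+1)}}{\tau_{2n+2}^{(m)}\tau_{2n+1,k}^{(m+1)}}.$$
   Context: $\mathbb{N}=\{0,1,2,\ldots\}$. The bi-moments satisfy $\mu_{i,j}=-\mu_{j,i}$. Pfaffian notation: for labels $a_1,\ldots,a_{2N}$, $\mathrm{Pf}(a_1,\ldots,a_{2N})$ is the Pfaffian of the $2N\times 2N$ skew-symmetric matrix whose $(p,q)$ entry is $\mathrm{Pf}(a_p,a_q)=-\mathrm{Pf}(a_q,a_p)$; the empty Pfaffian is $1$. For integer labels $i,j$ and the extra labels $d_1,\ldots,d_\ell,z$: $\mathrm{Pf}(i,j)=\mu_{i,j}$, $\mathrm{Pf}(d_k,i)=\beta^{(k)}_i$, $\mathrm{Pf}(i,z)=z^i$, $\mathrm{Pf}(d_k,z)=0$. Put $\tau_{2n}^{(m)}=\mathrm{Pf}(m,\ldots,m+2n-1)$ (so $\tau_0^{(m)}=1$) and $\tau_{2n+1,k}^{(m)}=\mathrm{Pf}(d_k,m,\ldots,m+2n)$. The $m$-th adjacent family of $\ell$-component partial-skew-orthogonal polynomials consists of the monic polynomials $$Q_{2n}^{(m)}(z)=\frac{1}{z^m\tau_{2n}^{(m)}}\mathrm{Pf}(m,\ldots,m+2n,z),\qquad Q_{2n+1,k}^{(m)}(z)=\frac{1}{z^m\tau_{2n+1,k}^{(m)}}\mathrm{Pf}(d_k,m,\ldots,m+2n+1,z),\quad k=1,\ldots,\ell.$$ Conventions: $\tau_{-1,k}^{(m)}=0$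 and $Q_{-1,k}^{(m)}=0$. *)

theory Defs
  imports Complex_Main "HOL-Combinatorics.Permutations" "HOL-Computational_Algebra.Polynomial"
begin

(* One permutation for each perfect matching {{s 0, s 1}, {s 2, s 3}, ...} of {0, ..., 2N-1}:
   smaller element first in each pair, pairs ordered by their first elements. *)
definition pf_perms :: "nat \<Rightarrow> (nat \<Rightarrow> nat) set" where
  "pf_perms N = {s. s permutes {..<2 * N} \<and>
     (\<forall>i<N. s (2 * i) < s (2 * i + 1)) \<and>
     (\<forall>i j. i < j \<and> j < N \<longrightarrow> s (2 * i) < s (2 * j))}"

(* Pfaffian of the 2N x 2N skew-symmetric matrix A (indices from 0). Summing over matchings
   instead of all permutations avoids the factor 1 / (2^N N!), so it is meaningful over
   any commutative ring. *)
definition pfaffian :: "nat \<Rightarrow> (nat \<Rightarrow> nat \<Rightarrow> 'a::comm_ring_1) \<Rightarrow> 'a" where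
  "pfaffian N A = (\<Sum>s\<in>pf_perms N. of_int (sign s) * (\<Prod>i<N. A (s (2 * i)) (s (2 * i + 1))))"

datatype label = Idx nat | D nat | Z

(* The value of (D k, D k') is never specified nor used: a label list contains at most one D. *)
fun pf_entry :: "(nat \<Rightarrow> nat \<Rightarrow> 'a) \<Rightarrow> (nat \<Rightarrow> nat \<Rightarrow> 'a) \<Rightarrow> 'a \<Rightarrow> label \<Rightarrow> label \<Rightarrow> 'a::comm_ring_1" where
  "pf_entry \<mu> \<beta> z (Idx i) (Idx j) = \<mu> i j"
| "pf_entry \<mu> \<beta> z (D k) (Idx i) = \<beta> k i"
| "pf_entry \<mu> \<beta> z (Idx i) (D k) = - \<beta> k i"
| "pf_entry \<mu> \<beta> z (Idx i) Z = z ^ i"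
| "pf_entry \<mu> \<beta> z Z (Idx i) = - (z ^ i)"
| "pf_entry \<mu> \<beta> z _ _ = 0"

definition Pf :: "(nat \<Rightarrow> nat \<Rightarrow> 'a) \<Rightarrow> (nat \<Rightarrow> nat \<Rightarrow> 'a) \<Rightarrow> 'a \<Rightarrow> label list \<Rightarrow> 'a::comm_ring_1" where
  "Pf \<mu> \<beta> z as = pfaffian (length as div 2) (\<lambda>p q. pf_entry \<mu> \<beta> z (as ! p) (as ! q))"

(* Here Z does not occur among the labels, so the value 0 given to z is immaterial. *)
definition tau_even :: "(nat \<Rightarrow> nat \<Rightarrow> real) \<Rightarrow> (nat \<Rightarrow> nat \<Rightarrow> real) \<Rightarrow> nat \<Rightarrow> nat \<Rightarrow> real" where
  "tau_even \<mu> \<beta> m n = Pf \<mu> \<beta> 0 (map Idx [m..<m + 2 * n])"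

(* tau_odd m k n is tau_{2n+1,k}^(m); n is an integer so that tau_{-1,k} is the case n = -1. *)
definition tau_odd :: "(nat \<Rightarrow> nat \<Rightarrow> real) \<Rightarrow> (nat \<Rightarrow> nat \<Rightarrow> real) \<Rightarrow> nat \<Rightarrow> nat \<Rightarrow> int \<Rightarrow> real" where
  "tau_odd \<mu> \<beta> m k n =
     (if n < 0 then 0 else Pf \<mu> \<beta> 0 (D k # map Idx [m..<m + 2 * nat n + 1]))"

(* The same Pfaffians over the ring of real polynomials, with z the polynomial variable. *)
definition Pf_poly :: "(nat \<Rightarrow> nat \<Rightarrow> real) \<Rightarrow> (nat \<Rightarrow> nat \<Rightarrow> real) \<Rightarrow> label list \<Rightarrow> real poly" where
  "Pf_poly \<mu> \<beta> = Pf (\<lambda>i j. [:\<mu> i j:]) (\<lambda>k i. [:\<beta> k i:]) [:0, 1:]"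

(* The divisions by z^m in Q_even and Q_odd are exact: see Q_even_exact and Q_odd_exact. *)
definition Q_even :: "(nat \<Rightarrow> nat \<Rightarrow> real) \<Rightarrow> (nat \<Rightarrow> nat \<Rightarrow> real) \<Rightarrow> nat \<Rightarrow> nat \<Rightarrow> real poly" where
  "Q_even \<mu> \<beta> m n = smult (1 / tau_even \<mu> \<beta> m n)
     (Pf_poly \<mu> \<beta> (map Idx [m..<m + 2 * n + 1] @ [Z]) div [:0, 1:] ^ m)"

(* Q_odd m k n is Q_{2n+1,k}^(m), with the same indexing as tau_odd. *)
definition Q_odd :: "(nat \<Rightarrow> nat \<Rightarrow> real) \<Rightarrow> (nat \<Rightarrow> nat \<Rightarrow> real) \<Rightarrow> nat \<Rightarrow> nat \<Rightarrow> int \<Rightarrow> real poly" where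
  "Q_odd \<mu> \<beta> m k n =
     (if n < 0 then 0 else smult (1 / tau_odd \<mu> \<beta> m k n)
       (Pf_poly \<mu> \<beta> (D k # map Idx [m..<m + 2 * nat n + 2] @ [Z]) div [:0, 1:] ^ m))"

definition coeff_E :: "(nat \<Rightarrow> nat \<Rightarrow> real) \<Rightarrow> (nat \<Rightarrow> nat \<Rightarrow> real) \<Rightarrow> nat \<Rightarrow> nat \<Rightarrow> nat \<Rightarrow> real" where
  "coeff_E \<mu> \<beta> m k n =
     (tau_even \<mu> \<beta> m n * tau_odd \<mu> \<beta> (m + 1) k (int n)) /
     (tau_odd \<mu> \<beta> m k (int n) * tau_even \<mu> \<beta> (m + 1) n)"

definition coeff_F :: "(nat \<Rightarrow> nat \<Rightarrow> real) \<Rightarrow> (nat \<Rightarrow> nat \<Rightarrow> real) \<Rightarrow> nat \<Rightarrow> nat \<Rightarrow> nat \<Rightarrow> real" where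
  "coeff_F \<mu> \<beta> m k n =
     (tau_even \<mu> \<beta> m (n + 1) * tau_odd \<mu> \<beta> (m + 1) k (int n - 1)) /
     (tau_odd \<mu> \<beta> m k (int n) * tau_even \<mu> \<beta> (m + 1) n)"

definition coeff_G :: "(nat \<Rightarrow> nat \<Rightarrow> real) \<Rightarrow> (nat \<Rightarrow> nat \<Rightarrow> real) \<Rightarrow> nat \<Rightarrow> nat \<Rightarrow> nat \<Rightarrow> real" where
  "coeff_G \<mu> \<beta> m k n =
     (tau_odd \<mu> \<beta> m k (int n) * tau_even \<mu> \<beta> (m + 1) (n + 1)) /
     (tau_even \<mu> \<beta> m (n + 1) * tau_odd \<mu> \<beta> (m + 1) k (int n))"

definition coeff_H :: "(nat \<Rightarrow> nat \<Rightarrow> real) \<Rightarrow> (nat \<Rightarrow> nat \<Rightarrow> real) \<Rightarrow> nat \<Rightarrow> nat \<Rightarrow> nat \<Rightarrow> real" where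
  "coeff_H \<mu> \<beta> m k n =
     (tau_odd \<mu> \<beta> m k (int n + 1) * tau_even \<mu> \<beta> (m + 1) n) /
     (tau_even \<mu> \<beta> m (n + 1) * tau_odd \<mu> \<beta> (m + 1) k (int n))"

lemma pf_entry_skew:
  assumes "\<And>i j. \<mu> i j = - \<mu> j i"
  shows "pf_entry \<mu> \<beta> z a b = - pf_entry \<mu> \<beta> z b a"
  by (cases a; cases b; simp; rule assms)

lemma pfaffian_dvd:
  fixes A :: "nat \<Rightarrow> nat \<Rightarrow> 'a::comm_ring_1"
  assumes "N > 0" and last: "\<And>p. p < 2 * N - 1 \<Longrightarrow> c dvd A p (2 * N - 1)"
  shows "c dvd pfaffian N A"
  unfolding pfaffian_def
proof (rule dvd_sum)
  fix s assume "s \<in> pf_perms N"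
  then have perm: "s permutes {..<2 * N}" and less: "\<And>i. i < N \<Longrightarrow> s (2 * i) < s (2 * i + 1)"
    by (auto simp: pf_perms_def)
  have "2 * N - 1 \<in> s ` {..<2 * N}"
    using permutes_image[OF perm] \<open>N > 0\<close> by auto
  then obtain p where p: "p < 2 * N" "s p = 2 * N - 1" by auto
  define i where "i = p div 2"
  have i: "i < N" using p(1) by (auto simp: i_def)
  have bound: "s (2 * i + 1) < 2 * N"
    using permutes_in_image[OF perm, of "2 * i + 1"] i by auto
  have "p \<noteq> 2 * i" using less[OF i] bound p(2) by auto
  then have "p = 2 * i + 1" by (auto simp: i_def)
  then have "c dvd A (s (2 * i)) (s (2 * i + 1))"
    using last[of "s (2 * i)"] less[OF i] p(2) by simp
  also have "\<dots> dvd (\<Prod>i<N. A (s (2 * i)) (s (2 * i + 1)))"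
    using i by (intro dvd_prodI) auto
  finally show "c dvd of_int (sign s) * (\<Prod>i<N. A (s (2 * i)) (s (2 * i + 1)))"
    by (rule dvd_mult)
qed

lemma Q_even_exact: "[:0, 1:] ^ m dvd Pf_poly \<mu> \<beta> (map Idx [m..<m + 2 * n + 1] @ [Z])"
  unfolding Pf_poly_def Pf_def
  by (rule pfaffian_dvd) (auto simp: nth_append le_imp_power_dvd simp del: upt_Suc)

lemma Q_odd_exact: "[:0, 1:] ^ m dvd Pf_poly \<mu> \<beta> (D k # map Idx [m..<m + 2 * n + 2] @ [Z])"
  unfolding Pf_poly_def Pf_def
  by (rule pfaffian_dvd) (auto simp: nth_append nth_Cons le_imp_power_dvd simp del: upt_Suc split: nat.split)

end

theory Submission
  imports Defs
begin

text \<open>Let \<open>A\<close> be the block of labels shared by both sides, namely \<open>m + 1, \<dots>, m + 2 n\<close> for the first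
  recurrence and \<open>m + 1, \<dots>, m + 2 n + 1\<close> for the second, and let \<open>a\<close>, \<open>b\<close> be the labels preceding and
  following \<open>A\<close>. After clearing denominators and multiplying by \<open>z\<^sup>m\<close>, the recurrences are the
  four-term quadratic relations between the Pfaffians obtained by distributing \<open>d\<^sub>k, a, b, z\<close> over
  two copies of \<open>A\<close>; the parity of \<open>A\<close> decides whether the splittings are 4+0 and 2+2, or 1+3.
  Both relations specialise one exchange identity between two lists of labels, in which all terms
  that repeat a label of \<open>A\<close> vanish.\<close>

subsection \<open>Expansion of a Pfaffian along its first row\<close>

text \<open>\<open>front_cycle j\<close> moves 1 to position \<open>j + 1\<close> and keeps the order of the numbers from 2 on, so a
  matching that pairs 0 with \<open>j + 1\<close> is \<open>front_cycle j\<close> after a shifted smaller matching.\<close>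

definition front_cycle :: "nat \<Rightarrow> nat \<Rightarrow> nat" where
  "front_cycle j p = (if p = 0 then 0 else if p = 1 then Suc j else if p \<le> Suc j then p - 1 else p)"

lemma front_cycle_0: "front_cycle 0 = id"
  by (auto simp: front_cycle_def fun_eq_iff)

text \<open>One adjacent transposition per step lets both membership in the symmetric group and the
  sign follow by induction on \<open>j\<close>.\<close>

lemma front_cycle_Suc: "front_cycle (Suc j) = transpose (Suc j) (Suc (Suc j)) \<circ> front_cycle j"
  by (auto simp: front_cycle_def fun_eq_iff transpose_def)

lemma front_cycle_permutes: "j < 2 * N + 1 \<Longrightarrow> front_cycle j permutes {..<2 * Suc N}"
proof (induction j)
  case 0
  show ?case unfolding front_cycle_0 by (rule permutes_id)
next
  case (Suc j)
  then show ?case unfolding front_cycle_Suc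
    by (intro permutes_compose permutes_swap_id) auto
qed

lemma sign_front_cycle: "sign (front_cycle j) = (- 1) ^ j"
proof (induction j)
  case 0
  then show ?case by (simp add: front_cycle_0)
next
  case (Suc j)
  have "permutation (front_cycle j)"
    \<comment> \<open>Any set that is large enough will do; \<open>N = j\<close> qualifies since
      \<open>j < 2 * j + 1\<close>.\<close>
    by (rule permutes_imp_permutation[OF _ front_cycle_permutes[of j j]]) auto
  then have "sign (front_cycle (Suc j)) = sign (transpose (Suc j) (Suc (Suc j))) * sign (front_cycle j)"
    unfolding front_cycle_Suc by (intro sign_compose permutation_swap_id)
  then show ?case
    using Suc.IH by (simp add: sign_swap_id)
qed

text \<open>This monotonicity carries the order conditions of a matching over to the smaller
  matching.\<close>

lemma front_cycle_less_iff:
  "front_cycle j (Suc (Suc p)) < front_cycle j (Suc (Suc q)) \<longleftrightarrow> p < q"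
  by (auto simp: front_cycle_def)

text \<open>Transport along the shift by 2, with the identity elsewhere: 0 and 1 stay free for the
  first pair.\<close>

definition shift_perm :: "nat \<Rightarrow> (nat \<Rightarrow> nat) \<Rightarrow> nat \<Rightarrow> nat" where
  "shift_perm N = map_permutation {..<2 * N} (\<lambda>p. Suc (Suc p))"

lemma Suc_Suc_image: "(\<lambda>p. Suc (Suc p)) ` {..<n} = {2..<Suc (Suc n)}"
proof -
  have "x \<in> (\<lambda>p. Suc (Suc p)) ` {..<n}" if "x \<in> {2..<Suc (Suc n)}" for x
    using that by (intro image_eqI[of _ _ "x - 2"]) auto
  then show ?thesis by auto
qed

lemma bij_betw_Suc_Suc: "bij_betw (\<lambda>p. Suc (Suc p)) {..<n} {2..<Suc (Suc n)}"
  by (auto simp: bij_betw_def inj_on_def Suc_Suc_image)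

lemma shift_perm_permutes:
  assumes "t permutes {..<2 * N}"
  shows "shift_perm N t permutes {..<2 * Suc N}" "shift_perm N t 0 = 0" "shift_perm N t 1 = 1"
proof -
  have *: "shift_perm N t permutes {2..<Suc (Suc (2 * N))}"
    unfolding shift_perm_def by (intro map_permutation_permutes bij_betw_Suc_Suc assms)
  show "shift_perm N t permutes {..<2 * Suc N}"
    by (rule permutes_subset[OF *]) auto
  show "shift_perm N t 0 = 0" "shift_perm N t 1 = 1"
    using permutes_not_in[OF *] by auto
qed

lemma shift_perm_apply: "p < 2 * N \<Longrightarrow> shift_perm N t (Suc (Suc p)) = Suc (Suc (t p))"
  unfolding shift_perm_def by (subst map_permutation_apply) (auto simp: inj_on_def)

lemma sign_shift_perm: "t permutes {..<2 * N} \<Longrightarrow> sign (shift_perm N t) = sign t"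
  unfolding shift_perm_def by (intro sign_map_permutation) (auto simp: inj_on_def)

text \<open>The number 0 cannot be the larger element of its pair, and the pair with the least first
  element comes first.\<close>

lemma pf_perms_0:
  assumes "s \<in> pf_perms (Suc N)"
  shows "s 0 = 0"
proof -
  have perm: "s permutes {..<2 * Suc N}"
    and less: "\<And>i. i < Suc N \<Longrightarrow> s (2 * i) < s (2 * i + 1)"
    and ord: "\<And>i j. i < j \<Longrightarrow> j < Suc N \<Longrightarrow> s (2 * i) < s (2 * j)"
    using assms by (auto simp: pf_perms_def)
  have "0 \<in> s ` {..<2 * Suc N}" using permutes_image[OF perm] by auto
  then obtain p where p: "p < 2 * Suc N" "s p = 0" by auto
  define i where "i = p div 2"
  have i: "i < Suc N" using p(1) by (auto simp: i_def)
  have "p \<noteq> 2 * i + 1" using less[OF i] p(2) by auto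
  then have "p = 2 * i" by (auto simp: i_def)
  then show ?thesis using ord[of 0 i] i p(2) by (cases "i = 0") auto
qed

text \<open>The conditions on the first pair \<open>0, Suc j\<close> hold automatically; the others
  compare values of \<open>front_cycle j\<close> on numbers from 2 on, where it is
  increasing.\<close>

lemma pf_perms_compose:
  assumes "j < 2 * N + 1" "t permutes {..<2 * N}"
  shows "front_cycle j \<circ> shift_perm N t \<in> pf_perms (Suc N) \<longleftrightarrow> t \<in> pf_perms N"
proof -
  let ?s = "front_cycle j \<circ> shift_perm N t"
  have s01: "?s 0 = 0" "?s (Suc 0) = Suc j"
    using shift_perm_permutes[OF assms(2)] by (auto simp: front_cycle_def)
  have s: "?s (Suc (Suc p)) = front_cycle j (Suc (Suc (t p)))" if "p < 2 * N" for p
    using that by (simp add: shift_perm_apply)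
  have spos: "0 < ?s (Suc (Suc p))" if "p < 2 * N" for p
    using s[OF that] by (simp add: front_cycle_def)
  have perm: "?s permutes {..<2 * Suc N}"
    by (intro permutes_compose shift_perm_permutes front_cycle_permutes assms)
  have pairs: "(\<forall>i<Suc N. ?s (2 * i) < ?s (2 * i + 1)) \<longleftrightarrow> (\<forall>i<N. t (2 * i) < t (2 * i + 1))"
    unfolding All_less_Suc2
    using s01 by (simp add: s front_cycle_less_iff del: o_apply)
  have order: "?s (2 * Suc i) < ?s (2 * Suc k) \<longleftrightarrow> t (2 * i) < t (2 * k)"
    if "i < N" "k < N" for i k
    using that by (simp add: s front_cycle_less_iff del: o_apply)
  have order0: "?s (2 * 0) < ?s (2 * Suc k)" if "k < N" for k
    using that s01 spos[of "2 * k"] by (simp del: o_apply)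
  have "(\<forall>i k. i < k \<and> k < Suc N \<longrightarrow> ?s (2 * i) < ?s (2 * k)) \<longleftrightarrow>
        (\<forall>i k. i < k \<and> k < N \<longrightarrow> t (2 * i) < t (2 * k))" (is "?L \<longleftrightarrow> ?R")
  proof
    assume L: ?L
    show ?R
    proof (intro allI impI)
      fix i k assume "i < k \<and> k < N"
      then show "t (2 * i) < t (2 * k)"
        using order[of i k] L[rule_format, of "Suc i" "Suc k"] by simp
    qed
  next
    assume R: ?R
    show ?L
    proof (intro allI impI)
      fix i k assume *: "i < k \<and> k < Suc N"
      then obtain k' where k: "k = Suc k'" by (cases k) auto
      show "?s (2 * i) < ?s (2 * k)"
      proof (cases i)
        case 0
        then show ?thesis using * k order0[of k'] by (simp del: o_apply)
      next
        case (Suc i')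
        then show ?thesis using * k order[of i' k'] R[rule_format, of i' k'] by (simp del: o_apply)
      qed
    qed
  qed
  with perm pairs assms(2) show ?thesis
    unfolding pf_perms_def mem_Collect_eq by blast
qed

text \<open>The value at 1 determines \<open>j\<close>; undoing \<open>front_cycle j\<close> and
  shifting down by 2 then recovers \<open>t\<close>.\<close>

lemma pf_perms_Suc_bij:
  "bij_betw (\<lambda>(j, t). front_cycle j \<circ> shift_perm N t) ({..<2 * N + 1} \<times> pf_perms N) (pf_perms (Suc N))"
  unfolding bij_betw_def
proof
  let ?h = "\<lambda>(j, t). front_cycle j \<circ> shift_perm N t"
  have perm: "t permutes {..<2 * N}" if "t \<in> pf_perms N" for t
    using that by (auto simp: pf_perms_def)
  show "inj_on ?h ({..<2 * N + 1} \<times> pf_perms N)"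
  proof (rule inj_onI)
    fix x y
    assume "x \<in> {..<2 * N + 1} \<times> pf_perms N" "y \<in> {..<2 * N + 1} \<times> pf_perms N" "?h x = ?h y"
    moreover obtain j t j' t' where xy: "x = (j, t)" "y = (j', t')" by fastforce
    ultimately have *: "j \<in> {..<2 * N + 1}" "t \<in> pf_perms N" "j' \<in> {..<2 * N + 1}" "t' \<in> pf_perms N"
      and eq: "front_cycle j \<circ> shift_perm N t = front_cycle j' \<circ> shift_perm N t'"
      by auto
    have "(front_cycle j \<circ> shift_perm N t) 1 = Suc j" "(front_cycle j' \<circ> shift_perm N t') 1 = Suc j'"
      using shift_perm_permutes[OF perm] * by (auto simp: front_cycle_def)
    with eq have j: "j = j'" by simp
    have "t p = t' p" for p
    proof (cases "p < 2 * N")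
      case True
      have "inj (front_cycle j)"
        using front_cycle_permutes[of j N] * permutes_inj by auto
      moreover have "front_cycle j (Suc (Suc (t p))) = front_cycle j (Suc (Suc (t' p)))"
        using fun_cong[OF eq, of "Suc (Suc p)"] True j by (simp add: shift_perm_apply)
      ultimately show ?thesis by (auto dest: injD)
    next
      case False
      then show ?thesis using perm[OF *(2)] perm[OF *(4)] by (simp add: permutes_not_in)
    qed
    with j show "x = y" unfolding xy by auto
  qed
  show "?h ` ({..<2 * N + 1} \<times> pf_perms N) = pf_perms (Suc N)"
  proof (intro set_eqI iffI)
    fix s assume s: "s \<in> pf_perms (Suc N)"
    then have sperm: "s permutes {..<2 * Suc N}" by (auto simp: pf_perms_def)
    have s0: "s 0 = 0" by (rule pf_perms_0[OF s])
    \<comment> \<open>Positivity of \<open>s 1\<close> makes the subtraction in the choice of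
      \<open>j\<close> exact.\<close>
    have "s (2 * 0) < s (2 * 0 + 1)" using s unfolding pf_perms_def by blast
    then have "s 1 > 0" by simp
    define j where "j = s 1 - 1"
    have s1: "s 1 = Suc j" using \<open>s 1 > 0\<close> by (simp add: j_def)
    have "s 1 < 2 * Suc N" using permutes_in_image[OF sperm, of 1] by simp
    then have j: "j < 2 * N + 1" using s1 by simp
    let ?c = "front_cycle j"
    have c: "?c permutes {..<2 * Suc N}" by (rule front_cycle_permutes[OF j])
    \<comment> \<open>Once the cycle is undone, 0 and 1 are fixed, so what remains permutes only the
      numbers from 2 on.\<close>
    define u where "u = inv ?c \<circ> s"
    have cu: "?c \<circ> u = s"
      unfolding u_def by (simp add: o_assoc permutes_inv_o(1)[OF c])
    have uperm: "u permutes {..<2 * Suc N}"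
      unfolding u_def by (intro permutes_compose permutes_inv sperm c)
    have "?c 0 = 0" "?c 1 = Suc j" by (auto simp: front_cycle_def)
    then have u01: "u 0 = 0" "u 1 = 1"
      using s0 s1 permutes_inverses(2)[OF c] unfolding u_def comp_def by metis+
    have uperm2: "u permutes {2..<Suc (Suc (2 * N))}"
    proof (rule permutes_superset[OF uperm])
      fix x assume "x \<in> {..<2 * Suc N} - {2..<Suc (Suc (2 * N))}"
      then have "x = 0 \<or> x = 1" by auto
      then show "u x = x" using u01 by auto
    qed
    define t where "t = map_permutation {2..<Suc (Suc (2 * N))} (\<lambda>p. p - 2) u"
    have bij: "bij_betw (\<lambda>p. p - 2) {2..<Suc (Suc (2 * N))} {..<2 * N}"
      by (rule bij_betw_byWitness[where f' = "\<lambda>p. Suc (Suc p)"]) auto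
    have tperm: "t permutes {..<2 * N}"
      unfolding t_def by (rule map_permutation_permutes[OF bij uperm2])
    have "shift_perm N t = u"
      unfolding shift_perm_def t_def
      by (rule map_permutation_compose_inv[OF bij uperm2]) auto
    then have s_eq: "?c \<circ> shift_perm N t = s" using cu by simp
    with s have "t \<in> pf_perms N" using pf_perms_compose[OF j tperm] by simp
    with j s_eq show "s \<in> ?h ` ({..<2 * N + 1} \<times> pf_perms N)"
      by (intro image_eqI[of _ _ "(j, t)"]) auto
  next
    fix s assume "s \<in> ?h ` ({..<2 * N + 1} \<times> pf_perms N)"
    then obtain j t where *: "j < 2 * N + 1" "t \<in> pf_perms N" "s = front_cycle j \<circ> shift_perm N t"
      by auto
    then show "s \<in> pf_perms (Suc N)"
      using pf_perms_compose[of j N t] perm[of t] by simp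
  qed
qed

text \<open>Group the matchings by the partner \<open>Suc j\<close> of 0: the cycle contributes the
  sign \<open>(- 1) ^ j\<close>, the pair of 0 the entry \<open>A 0 (Suc j)\<close>, and the rest is
  a matching of the remaining indices.\<close>

lemma pfaffian_Suc:
  "pfaffian (Suc N) A = (\<Sum>j<2 * N + 1. (- 1) ^ j * A 0 (Suc j) *
     pfaffian N (\<lambda>p q. A (front_cycle j (Suc (Suc p))) (front_cycle j (Suc (Suc q)))))"
proof -
  let ?g = "\<lambda>s. of_int (sign s) * (\<Prod>i<Suc N. A (s (2 * i)) (s (2 * i + 1)))"
  let ?B = "\<lambda>j p q. A (front_cycle j (Suc (Suc p))) (front_cycle j (Suc (Suc q)))"
  have g: "?g (front_cycle j \<circ> shift_perm N t) =
      (- 1) ^ j * A 0 (Suc j) * (of_int (sign t) * (\<Prod>i<N. ?B j (t (2 * i)) (t (2 * i + 1))))"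
    if "j < 2 * N + 1" "t \<in> pf_perms N" for j t
  proof -
    let ?s = "front_cycle j \<circ> shift_perm N t"
    have t: "t permutes {..<2 * N}" using that by (simp add: pf_perms_def)
    have perms: "permutation (front_cycle j)" "permutation (shift_perm N t)"
      using front_cycle_permutes[OF that(1)] shift_perm_permutes(1)[OF t]
      by (auto intro: permutes_imp_permutation[rotated])
    have sgn: "sign ?s = (- 1) ^ j * sign t"
      by (simp add: sign_compose[OF perms] sign_front_cycle sign_shift_perm[OF t])
    have s01: "?s 0 = 0" "?s (Suc 0) = Suc j"
      using shift_perm_permutes[OF t] by (auto simp: front_cycle_def)
    have "(\<Prod>i<Suc N. A (?s (2 * i)) (?s (2 * i + 1))) =
        A 0 (Suc j) * (\<Prod>i<N. A (?s (2 * Suc i)) (?s (2 * Suc i + 1)))"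
      unfolding prod.lessThan_Suc_shift using s01 by (simp del: o_apply)
    also have "(\<Prod>i<N. A (?s (2 * Suc i)) (?s (2 * Suc i + 1))) =
        (\<Prod>i<N. ?B j (t (2 * i)) (t (2 * i + 1)))"
      by (intro prod.cong refl) (simp add: shift_perm_apply)
    finally show ?thesis by (simp only: sgn of_int_mult of_int_power of_int_minus of_int_1 mult_ac)
  qed
  have "pfaffian (Suc N) A = (\<Sum>(j, t)\<in>{..<2 * N + 1} \<times> pf_perms N. ?g (front_cycle j \<circ> shift_perm N t))"
    unfolding pfaffian_def
    by (subst sum.reindex_bij_betw[OF pf_perms_Suc_bij, symmetric]) (simp add: case_prod_beta)
  also have "\<dots> = (\<Sum>(j, t)\<in>{..<2 * N + 1} \<times> pf_perms N.
      (- 1) ^ j * A 0 (Suc j) * (of_int (sign t) * (\<Prod>i<N. ?B j (t (2 * i)) (t (2 * i + 1)))))"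
    by (intro sum.cong refl) (use g in auto)
  also have "\<dots> = (\<Sum>j<2 * N + 1. (- 1) ^ j * A 0 (Suc j) * pfaffian N (?B j))"
    unfolding pfaffian_def sum_distrib_left by (rule sum.cartesian_product[symmetric])
  finally show ?thesis .
qed

lemma pfaffian_0: "pfaffian 0 A = 1"
proof -
  have "pf_perms 0 = {id}" by (auto simp: pf_perms_def)
  then show ?thesis by (simp add: pfaffian_def)
qed

subsection \<open>Pfaffians of lists of labels\<close>

definition delete_nth :: "nat \<Rightarrow> 'b list \<Rightarrow> 'b list" where
  "delete_nth i xs = take i xs @ drop (Suc i) xs"

lemma length_delete_nth [simp]: "i < length xs \<Longrightarrow> length (delete_nth i xs) = length xs - 1"
  by (auto simp: delete_nth_def)

lemma nth_delete_nth:
  "i < length xs \<Longrightarrow> delete_nth i xs ! p = xs ! (if p < i then p else Suc p)"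
  by (auto simp: delete_nth_def nth_append min_def)

lemma delete_nth_Cons_0 [simp]: "delete_nth 0 (x # xs) = xs"
  by (simp add: delete_nth_def)

lemma delete_nth_Cons_Suc [simp]: "delete_nth (Suc i) (x # xs) = x # delete_nth i xs"
  by (simp add: delete_nth_def)

lemma delete_nth_append1: "i < length xs \<Longrightarrow> delete_nth i (xs @ ys) = delete_nth i xs @ ys"
  by (simp add: delete_nth_def)

lemma delete_nth_append2: "delete_nth (length xs + i) (xs @ ys) = xs @ delete_nth i ys"
  by (simp add: delete_nth_def)

lemma delete_nth_delete_nth:
  assumes "j < i" "i < length xs"
  shows "delete_nth j (delete_nth i xs) = delete_nth (i - 1) (delete_nth j xs)"
  using assms by (intro nth_equalityI) (auto simp: length_delete_nth nth_delete_nth)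

text \<open>The first-row expansion turned into a recursion on labels. Lists of odd length get the
  value 0, so the identities between list Pfaffians can be stated without parity conditions.\<close>

fun pf_list :: "('b \<Rightarrow> 'b \<Rightarrow> 'a::comm_ring_1) \<Rightarrow> 'b list \<Rightarrow> 'a" where
  "pf_list e [] = 1"
| "pf_list e (x # xs) = (\<Sum>i<length xs. (- 1) ^ i * e x (xs ! i) * pf_list e (delete_nth i xs))"

declare pf_list.simps(2) [simp del]

text \<open>After the shift by 2, \<open>front_cycle j\<close> enumerates in order the indices that
  survive the deletion of the partner of the first label.\<close>

lemma pf_list_eq_pfaffian:
  "length xs = 2 * N \<Longrightarrow> pf_list e xs = pfaffian N (\<lambda>p q. e (xs ! p) (xs ! q))"
proof (induction N arbitrary: xs)
  case 0
  then show ?case by (simp add: pfaffian_0)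
next
  case (Suc N)
  then obtain x ys where xs: "xs = x # ys" "length ys = 2 * N + 1"
    by (cases xs) auto
  have "pf_list e (delete_nth j ys) =
      pfaffian N (\<lambda>p q. e (xs ! front_cycle j (Suc (Suc p))) (xs ! front_cycle j (Suc (Suc q))))"
    if "j < 2 * N + 1" for j
  proof -
    have "xs ! front_cycle j (Suc (Suc p)) = delete_nth j ys ! p" for p
      using that xs by (auto simp: nth_delete_nth front_cycle_def)
    then show ?thesis using Suc.IH[of "delete_nth j ys"] that xs by simp
  qed
  then show ?case
    unfolding pfaffian_Suc xs(1) pf_list.simps(2) xs(2) by (intro sum.cong refl) (auto simp: xs(1))
qed

section \<open>Antisymmetry in the labels and the exchange identity\<close>

context
  fixes e :: "'b \<Rightarrow> 'b \<Rightarrow> 'a::comm_ring_1"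
  assumes skew: "\<And>a b. e a b = - e b a"
begin

text \<open>Expand along the first two labels. The term pairing \<open>x\<close> with
  \<open>y\<close> changes sign by skewness; in the others, exchanging the partners of
  \<open>x\<close> and \<open>y\<close> flips the sign.\<close>

lemma pf_list_swap_first: "pf_list e (x # y # zs) = - pf_list e (y # x # zs)"
proof -
  let ?n = "length zs"
  let ?I = "{..<?n} \<times> {..<?n - 1}"
  let ?P = "\<lambda>i j. pf_list e (delete_nth j (delete_nth i zs))"
  let ?F = "\<lambda>x y (i, j). (- 1) ^ (i + j) * e x (zs ! i) * e y (delete_nth i zs ! j) * ?P i j"
  \<comment> \<open>The index \<open>j\<close> is counted after the deletion of position
    \<open>i\<close>. This involution chooses the same two positions in the opposite order, which
    changes \<open>i + j\<close> by exactly 1.\<close>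
  let ?\<phi> = "\<lambda>(i, j). if j < i then (j, i - 1) else (Suc j, i)"
  have expand: "pf_list e (x # y # zs) = e x y * pf_list e zs - (\<Sum>p\<in>?I. ?F x y p)" for x y
  proof -
    have "pf_list e (x # y # zs) = e x y * pf_list e zs +
        (\<Sum>i<?n. (- 1) ^ Suc i * e x (zs ! i) * pf_list e (y # delete_nth i zs))"
      by (subst pf_list.simps(2)) (simp only: length_Cons sum.lessThan_Suc_shift, simp)
    also have "(\<Sum>i<?n. (- 1) ^ Suc i * e x (zs ! i) * pf_list e (y # delete_nth i zs)) =
        (\<Sum>i<?n. \<Sum>j<?n - 1. - ?F x y (i, j))"
    proof (intro sum.cong refl)
      fix i assume "i \<in> {..<?n}"
      then show "(- 1) ^ Suc i * e x (zs ! i) * pf_list e (y # delete_nth i zs) =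
          (\<Sum>j<?n - 1. - ?F x y (i, j))"
        by (simp add: pf_list.simps(2) length_delete_nth sum_distrib_left sum_negf power_add mult_ac)
    qed
    also have "\<dots> = - (\<Sum>p\<in>?I. ?F x y p)"
      by (simp add: sum.cartesian_product sum_negf case_prod_beta)
    finally show ?thesis by simp
  qed
  have "(\<Sum>p\<in>?I. ?F x y p) = (\<Sum>p\<in>?I. - ?F y x p)"
  proof (rule sum.reindex_bij_witness[where i = ?\<phi> and j = ?\<phi>])
    fix p assume p: "p \<in> ?I"
    obtain i j where ij: "p = (i, j)" "i < ?n" "j < ?n - 1" using p by auto
    show "?\<phi> (?\<phi> p) = p" "?\<phi> p \<in> ?I" using ij by auto
    show "- ?F y x (?\<phi> p) = ?F x y p"
    proof (cases "j < i")
      case True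
      then obtain i' where "i = Suc i'" by (cases i) auto
      then show ?thesis using True ij delete_nth_delete_nth[of j i zs]
        by (simp add: nth_delete_nth mult_ac add_ac)
    next
      case False
      then show ?thesis using ij delete_nth_delete_nth[of i "Suc j" zs]
        by (simp add: nth_delete_nth mult_ac add_ac)
    qed
  next
    fix p assume p: "p \<in> ?I"
    obtain i j where ij: "p = (i, j)" "i < ?n" "j < ?n - 1" using p by auto
    show "?\<phi> (?\<phi> p) = p" "?\<phi> p \<in> ?I" using ij by auto
  qed
  then have "(\<Sum>p\<in>?I. ?F x y p) = - (\<Sum>p\<in>?I. ?F y x p)" by (simp add: sum_negf)
  then show ?thesis unfolding expand using skew[of x y] by simp
qed

text \<open>Expand along the first label \<open>u\<close>. If its partner is neither
  \<open>x\<close> nor \<open>y\<close>, a shorter list remains and induction applies; the two terms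
  in which it is \<open>x\<close> or \<open>y\<close> have opposite signs and trade places.\<close>

lemma pf_list_swap: "pf_list e (us @ x # y # vs) = - pf_list e (us @ y # x # vs)"
proof (induction "length us + length vs" arbitrary: us vs rule: less_induct)
  case less
  show ?case
  proof (cases us)
    case Nil
    show ?thesis unfolding Nil append_Nil by (rule pf_list_swap_first)
  next
    case (Cons u ws)
    let ?k = "length ws"
    have expand: "pf_list e (u # ws @ x # y # vs) =
        (\<Sum>i<?k. (- 1) ^ i * e u (ws ! i) * pf_list e (delete_nth i ws @ x # y # vs)) +
        (- 1) ^ ?k * (e u x * pf_list e (ws @ y # vs) - e u y * pf_list e (ws @ x # vs)) +
        (\<Sum>i<length vs. (- 1) ^ (?k + i) * e u (vs ! i) * pf_list e (ws @ x # y # delete_nth i vs))"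
      for x y
    proof -
      \<comment> \<open>The range of summation is cut according to whether the partner of
        \<open>u\<close> lies in \<open>ws\<close>, is \<open>x\<close> or \<open>y\<close>, or lies
        in \<open>vs\<close>.\<close>
      have split: "(\<Sum>i<a + b. f i) = (\<Sum>i<a. f i) + (\<Sum>i<b. f (a + i))" for a b and f :: "nat \<Rightarrow> 'a"
        by (induction b) (simp_all add: add_ac)
      have d0: "delete_nth ?k (ws @ x # y # vs) = ws @ y # vs"
        using delete_nth_append2[of ws 0] by simp
      have d: "delete_nth (?k + i) (ws @ x # y # vs) = ws @ delete_nth i (x # y # vs)" for i
        by (rule delete_nth_append2)
      have d1: "delete_nth (Suc ?k) (ws @ x # y # vs) = ws @ x # vs"
        using d[of 1] by simp
      have d2: "delete_nth (Suc (Suc (i + ?k))) (ws @ x # y # vs) = ws @ x # y # delete_nth i vs" for i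
        using d[of "Suc (Suc i)"] by (simp add: add.commute)
      have len: "length (ws @ x # y # vs) = ?k + Suc (Suc (length vs))" by simp
      show ?thesis
        unfolding pf_list.simps(2) len split sum.lessThan_Suc_shift
        by (simp add: d0 d1 d2 delete_nth_append1 nth_append algebra_simps
            cong: sum.cong_simp)
    qed
    have "pf_list e (delete_nth i ws @ x # y # vs) = - pf_list e (delete_nth i ws @ y # x # vs)"
      if "i < ?k" for i
      by (rule less) (use that Cons in simp)
    moreover have "pf_list e (ws @ x # y # delete_nth i vs) = - pf_list e (ws @ y # x # delete_nth i vs)"
      if "i < length vs" for i
      by (rule less) (use that Cons in simp)
    ultimately show ?thesis unfolding Cons append_Cons expand
      by (simp add: sum_negf algebra_simps cong: sum.cong_simp)
  qed
qed

text \<open>One adjacent swap, hence one sign, for each label of \<open>vs\<close> that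
  \<open>x\<close> passes.\<close>

lemma pf_list_move: "pf_list e (us @ vs @ x # ws) = (- 1) ^ length vs * pf_list e (us @ x # vs @ ws)"
proof (induction vs arbitrary: us)
  case (Cons v vs)
  have "pf_list e (us @ (v # vs) @ x # ws) = (- 1) ^ length vs * pf_list e (us @ v # x # vs @ ws)"
    using Cons.IH[of "us @ [v]"] by simp
  then show ?case by (simp add: pf_list_swap[of us v])
qed simp

text \<open>Expanding every Pfaffian along its first label turns both sums into the same double sum
  over the entries \<open>e x y\<close> with \<open>x\<close> in \<open>X\<close> and \<open>y\<close> in \<open>Y\<close>, with opposite signs.\<close>

lemma pf_list_exchange:
  "(\<Sum>i<length X. (- 1) ^ i * pf_list e (delete_nth i X) * pf_list e (X ! i # Y)) +
   (\<Sum>j<length Y. (- 1) ^ j * pf_list e (Y ! j # X) * pf_list e (delete_nth j Y)) = 0"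
proof -
  let ?G = "\<lambda>i j. (- 1) ^ (i + j) * e (X ! i) (Y ! j) * pf_list e (delete_nth i X) * pf_list e (delete_nth j Y)"
  have "(\<Sum>i<length X. (- 1) ^ i * pf_list e (delete_nth i X) * pf_list e (X ! i # Y)) =
      (\<Sum>i<length X. \<Sum>j<length Y. ?G i j)"
    by (simp add: pf_list.simps(2) sum_distrib_left power_add mult_ac)
  also have "\<dots> = (\<Sum>j<length Y. \<Sum>i<length X. ?G i j)" by (rule sum.swap)
  also have "\<dots> = - (\<Sum>j<length Y. (- 1) ^ j * pf_list e (Y ! j # X) * pf_list e (delete_nth j Y))"
    by (simp add: pf_list.simps(2) sum_distrib_left sum_distrib_right power_add mult_ac
        skew[of "Y ! j" "X ! i" for i j] flip: sum_negf)
  finally show ?thesis by simp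
qed

end

subsection \<open>Quadratic relations\<close>

context
  fixes e :: "'b \<Rightarrow> 'b \<Rightarrow> 'a::{idom, ring_char_0}"
  assumes skew: "\<And>a b. e a b = - e b a"
begin

text \<open>Bring the two copies of \<open>x\<close> next to each other: swapping them gives a value
  equal to its own negative, which is 0 in characteristic 0.\<close>

lemma pf_list_repeated:
  assumes "x \<in> set xs"
  shows "pf_list e (x # xs) = 0"
proof -
  obtain vs ws where xs: "xs = vs @ x # ws" using assms by (auto simp: in_set_conv_decomp)
  have "2 * pf_list e (x # x # vs @ ws) = 0"
    using pf_list_swap_first[of e, OF skew, of x x "vs @ ws"] by (metis mult_2 eq_neg_iff_add_eq_0)
  then have "pf_list e (x # x # vs @ ws) = 0" by simp
  then show ?thesis
    using pf_list_move[of e, OF skew, of "[x]" vs x ws] xs by simp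
qed

text \<open>The exchange identity for \<open>a # A\<close> and \<open>b # c # d # A\<close>: one
  term of the first sum survives, and three of the second.\<close>

lemma pf_list_plucker_even:
  "pf_list e A * pf_list e (a # b # c # d # A) =
     pf_list e (a # b # A) * pf_list e (c # d # A) - pf_list e (a # c # A) * pf_list e (b # d # A)
     + pf_list e (a # d # A) * pf_list e (b # c # A)"
proof -
  have 1: "pf_list e (A ! i # b # c # d # A) = 0" if "i < length A" for i
    using pf_list_repeated[of "A ! i"] that by simp
  have 2: "pf_list e (A ! i # a # A) = 0" if "i < length A" for i
    using pf_list_repeated[of "A ! i"] that by simp
  have "pf_list e (x # y # A) = - pf_list e (y # x # A)" for x y
    by (rule pf_list_swap_first[of e, OF skew])
  from this[of b a] this[of c a] this[of d a] show ?thesis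
    using pf_list_exchange[of e, OF skew, of "a # A" "b # c # d # A"]
    by (simp add: sum.lessThan_Suc_shift 1 2 algebra_simps del: sum.lessThan_Suc)
qed

text \<open>The exchange identity for \<open>A\<close> and \<open>a # b # c # d # A\<close>: the
  first sum vanishes entirely, and four terms of the second survive.\<close>

lemma pf_list_plucker_odd:
  "pf_list e (a # A) * pf_list e (b # c # d # A) - pf_list e (b # A) * pf_list e (a # c # d # A)
     + pf_list e (c # A) * pf_list e (a # b # d # A) - pf_list e (d # A) * pf_list e (a # b # c # A) = 0"
proof -
  have 1: "pf_list e (A ! i # a # b # c # d # A) = 0" if "i < length A" for i
    using pf_list_repeated[of "A ! i"] that by simp
  have 2: "pf_list e (A ! i # A) = 0" if "i < length A" for i
    using pf_list_repeated[of "A ! i"] that by simp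
  show ?thesis
    using pf_list_exchange[of e, OF skew, of A "a # b # c # d # A"]
    by (simp add: sum.lessThan_Suc_shift 1 2 algebra_simps del: sum.lessThan_Suc)
qed

lemma pf_list_move_last: "pf_list e (us @ A @ [x]) = (- 1) ^ length A * pf_list e (us @ x # A)"
  using pf_list_move[of e, OF skew, of us A x "[]"] by simp

lemma pf_list_move_last2: "pf_list e (us @ A @ [x, y]) = pf_list e (us @ x # y # A)"
proof -
  have "pf_list e (us @ A @ [x, y]) = (- 1) ^ length A * pf_list e (us @ x # A @ [y])"
    using pf_list_move[of e, OF skew, of us A x "[y]"] by simp
  also have "\<dots> = pf_list e (us @ x # y # A)"
    using pf_list_move_last[of "us @ [x]" A y] by simp
  finally show ?thesis .
qed

text \<open>Here \<open>b\<close> and \<open>z\<close> move behind \<open>A\<close>, so that the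
  labels appear in the order used for the polynomials; passing an even number of labels costs no
  sign.\<close>

lemma pf_list_split_even:
  assumes "even (length A)"
  shows "pf_list e (d # a # A @ [b, z]) * pf_list e A + pf_list e (d # A @ [b]) * pf_list e (a # A @ [z]) =
    pf_list e (d # a # A) * pf_list e (A @ [b, z]) + pf_list e (a # A @ [b]) * pf_list e (d # A @ [z])"
  using pf_list_plucker_even[of A d a b z] assms
    pf_list_move_last2[of "[d, a]" A b z] pf_list_move_last[of "[d]" A] pf_list_move_last[of "[a]" A]
    pf_list_move_last2[of "[]" A b z]
  by (simp add: algebra_simps)

text \<open>Moving \<open>b\<close> and \<open>z\<close> together behind \<open>A\<close> costs no
  sign. Where they sit in different factors, each move gives -1 and the signs cancel in the
  product.\<close>

lemma pf_list_split_odd: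
  assumes "odd (length A)"
  shows "pf_list e (a # A @ [b, z]) * pf_list e (d # A) + pf_list e (A @ [b]) * pf_list e (d # a # A @ [z]) =
    pf_list e (a # A) * pf_list e (d # A @ [b, z]) + pf_list e (d # a # A @ [b]) * pf_list e (A @ [z])"
  using pf_list_plucker_odd[of d A a b z] assms
    pf_list_move_last2[of "[a]" A b z] pf_list_move_last2[of "[d]" A b z]
    pf_list_move_last[of "[]" A] pf_list_move_last[of "[d, a]" A]
  by (simp add: algebra_simps)

end

subsection \<open>The adjacent families\<close>

definition poly_entry :: "(nat \<Rightarrow> nat \<Rightarrow> real) \<Rightarrow> (nat \<Rightarrow> nat \<Rightarrow> real) \<Rightarrow> label \<Rightarrow> label \<Rightarrow> real poly" where
  "poly_entry \<mu> \<beta> = pf_entry (\<lambda>i j. [:\<mu> i j:]) (\<lambda>k i. [:\<beta> k i:]) [:0, 1:]"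

lemma poly_entry_skew:
  assumes "\<And>i j. \<mu> i j = - \<mu> j i"
  shows "poly_entry \<mu> \<beta> a b = - poly_entry \<mu> \<beta> b a"
  unfolding poly_entry_def
proof (rule pf_entry_skew)
  show "[:\<mu> i j:] = - [:\<mu> j i:]" for i j
    using assms[of i j] by simp
qed

lemma Pf_poly_eq_pf_list: "even (length xs) \<Longrightarrow> Pf_poly \<mu> \<beta> xs = pf_list (poly_entry \<mu> \<beta>) xs"
  unfolding Pf_poly_def Pf_def poly_entry_def by (rule pf_list_eq_pfaffian[symmetric]) simp

lemma Pf_eq_pf_list: "even (length xs) \<Longrightarrow> Pf \<mu> \<beta> z xs = pf_list (pf_entry \<mu> \<beta> z) xs"
  unfolding Pf_def by (rule pf_list_eq_pfaffian[symmetric]) simp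

lemma set_delete_nth: "set (delete_nth i xs) \<subseteq> set xs"
  by (auto simp: delete_nth_def dest: in_set_takeD in_set_dropD)

text \<open>The expansion uses only ring operations, so it commutes with the embedding of constants
  into polynomials.\<close>

lemma pf_list_const_poly:
  fixes e :: "'b \<Rightarrow> 'b \<Rightarrow> 'a::comm_ring_1"
  assumes "\<And>a b. a \<in> set xs \<Longrightarrow> b \<in> set xs \<Longrightarrow> e' a b = [:e a b:]"
  shows "pf_list e' xs = [:pf_list e xs:]"
  using assms
proof (induction "length xs" arbitrary: xs rule: less_induct)
  case less
  show ?case
  proof (cases xs)
    case Nil
    then show ?thesis by (simp add: one_pCons)
  next
    case (Cons x ys)
    have "(- 1) ^ i * e' x (ys ! i) * pf_list e' (delete_nth i ys) =
        [:(- 1) ^ i * e x (ys ! i) * pf_list e (delete_nth i ys):]" if "i < length ys" for i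
    proof -
      have "pf_list e' (delete_nth i ys) = [:pf_list e (delete_nth i ys):]"
        by (rule less.hyps) (use that Cons set_delete_nth[of i ys] less.prems in auto)
      moreover have "e' x (ys ! i) = [:e x (ys ! i):]" using that Cons less.prems by simp
      moreover have "(- 1) ^ i = [:(- 1) ^ i :: 'a:]"
        by (induction i) (auto simp: one_pCons)
      ultimately show ?thesis by (simp add: mult_ac)
    qed
    then show ?thesis unfolding Cons pf_list.simps(2) sum_to_poly[symmetric] by (intro sum.cong) auto
  qed
qed

lemma poly_entry_const:
  assumes "a \<noteq> Z" "b \<noteq> Z"
  shows "poly_entry \<mu> \<beta> a b = [:pf_entry \<mu> \<beta> 0 a b:]"
  using assms by (cases a; cases b) (simp_all add: poly_entry_def)

lemma pf_list_Pf:
  assumes "even (length xs)" "Z \<notin> set xs"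
  shows "pf_list (poly_entry \<mu> \<beta>) xs = [:Pf \<mu> \<beta> 0 xs:]"
  unfolding Pf_eq_pf_list[OF assms(1)]
  by (rule pf_list_const_poly) (use assms(2) in \<open>auto intro!: poly_entry_const\<close>)

lemma pf_list_tau_even: "pf_list (poly_entry \<mu> \<beta>) (map Idx [m..<m + 2 * n]) = [:tau_even \<mu> \<beta> m n:]"
  unfolding tau_even_def by (rule pf_list_Pf) auto

lemma pf_list_tau_odd:
  "pf_list (poly_entry \<mu> \<beta>) (D k # map Idx [m..<m + 2 * n + 1]) = [:tau_odd \<mu> \<beta> m k (int n):]"
  unfolding tau_odd_def by (subst pf_list_Pf) (auto simp del: upt_Suc)

text \<open>Exactness of the division by \<open>[:0, 1:] ^ m\<close> allows the normalisation to be
  undone.\<close>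

lemma pf_list_Q_even:
  assumes "tau_even \<mu> \<beta> m n \<noteq> 0"
  shows "pf_list (poly_entry \<mu> \<beta>) (map Idx [m..<m + 2 * n + 1] @ [Z]) =
    [:tau_even \<mu> \<beta> m n:] * [:0, 1:] ^ m * Q_even \<mu> \<beta> m n"
  using assms Q_even_exact[of m \<mu> \<beta> n]
  unfolding Q_even_def by (simp add: Pf_poly_eq_pf_list del: upt_Suc)

text \<open>The subscript \<open>int n - 1\<close> lets the conventions for index -1 be covered by
  \<open>n = 0\<close>.\<close>

lemma pf_list_Q_odd:
  assumes "\<And>n. tau_odd \<mu> \<beta> m k (int n) \<noteq> 0"
  shows "pf_list (poly_entry \<mu> \<beta>) (D k # map Idx [m..<m + 2 * n] @ [Z]) =
    [:tau_odd \<mu> \<beta> m k (int n - 1):] * [:0, 1:] ^ m * Q_odd \<mu> \<beta> m k (int n - 1)"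
proof (cases n)
  case 0
  \<comment> \<open>Only \<open>D k\<close> and \<open>Z\<close> remain, and their entry is 0, in
    agreement with the value 0 of \<open>tau_odd\<close> at -1.\<close>
  then show ?thesis by (simp add: tau_odd_def pf_list.simps(2) poly_entry_def)
next
  case (Suc n')
  then show ?thesis using assms[of n'] Q_odd_exact[of m \<mu> \<beta> k n']
    unfolding Q_odd_def by (simp add: Pf_poly_eq_pf_list del: upt_Suc)
qed

text \<open>Clears denominators: \<open>c\<close> is the denominator common to the two coefficients
  of a recurrence, \<open>u\<close> and \<open>v\<close> are their numerators, and \<open>y\<close>
  is the power \<open>z^m\<close>.\<close>

lemma cancel_scaled:
  fixes p q r s x y :: "'a::field poly"
  assumes "c \<noteq> 0" "y \<noteq> 0"
    and eq: "smult c (y * p) + smult u (y * q) = x * (smult c (y * r) + smult v (y * s))"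
  shows "p + smult (u / c) q = x * (r + smult (v / c) s)"
proof -
  have "smult c y * (p + smult (u / c) q) = smult c (y * p) + smult u (y * q)"
    using assms(1) by (simp add: algebra_simps)
  also have "\<dots> = smult c y * (x * (r + smult (v / c) s))"
    unfolding eq using assms(1) by (simp add: algebra_simps)
  finally show ?thesis by (rule mult_left_cancel[THEN iffD1, rotated]) (use assms(1,2) in simp)
qed

section \<open>The two recurrences for a fixed component\<close>

context
  fixes \<mu> \<beta> :: "nat \<Rightarrow> nat \<Rightarrow> real" and k :: nat
  assumes skew: "\<And>i j. \<mu> i j = - \<mu> j i"
    and tau_even_nz: "\<And>m n. tau_even \<mu> \<beta> m n \<noteq> 0"
    and tau_odd_nz: "\<And>m n. tau_odd \<mu> \<beta> m k (int n) \<noteq> 0"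
begin

text \<open>The four products of \<open>pf_list_split_even\<close>, taken in order, become the four
  terms of the recurrence once each factor is read as a \<open>tau\<close> or as a scaled
  polynomial.\<close>

lemma Q_odd_recurrence:
  "Q_odd \<mu> \<beta> m k (int n) + smult (coeff_E \<mu> \<beta> m k n) (Q_even \<mu> \<beta> m n) =
     [:0, 1:] * (Q_even \<mu> \<beta> (m + 1) n + smult (coeff_F \<mu> \<beta> m k n) (Q_odd \<mu> \<beta> (m + 1) k (int n - 1)))"
proof -
  let ?P = "pf_list (poly_entry \<mu> \<beta>)"
  define A where "A = map Idx [m + 1..<m + 1 + 2 * n]"
  define a b where "a = Idx m" and "b = Idx (m + 2 * n + 1)"
  \<comment> \<open>Each label list of the quadratic relation is matched with the run of consecutive
    indices that defines a \<open>tau\<close> or a polynomial, so that the facts below can be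
    folded.\<close>
  have lists:
    "D k # a # A @ [b, Z] = D k # map Idx [m..<m + 2 * Suc n] @ [Z]"
    "D k # A @ [b] = D k # map Idx [m + 1..<m + 1 + 2 * n + 1]"
    "a # A @ [Z] = map Idx [m..<m + 2 * n + 1] @ [Z]"
    "D k # a # A = D k # map Idx [m..<m + 2 * n + 1]"
    "A @ [b, Z] = map Idx [m + 1..<m + 1 + 2 * n + 1] @ [Z]"
    "a # A @ [b] = map Idx [m..<m + 2 * (n + 1)]"
    "D k # A @ [Z] = D k # map Idx [m + 1..<m + 1 + 2 * n] @ [Z]"
    by (simp_all add: A_def a_def b_def upt_conv_Cons)
  note Pf_Q =
    pf_list_Q_odd[where m = m and n = "Suc n", OF tau_odd_nz, folded lists(1)]
    pf_list_Q_even[where m = m and n = n, OF tau_even_nz, folded lists(3)]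
    pf_list_Q_even[where m = "m + 1" and n = n, OF tau_even_nz, folded lists(5)]
    pf_list_Q_odd[where m = "m + 1" and n = n, OF tau_odd_nz, folded lists(7)]
  note Pf_tau =
    pf_list_tau_even[where m = "m + 1" and n = n, folded A_def]
    pf_list_tau_odd[where k = k and m = "m + 1" and n = n, folded lists(2)]
    pf_list_tau_odd[where k = k and m = m and n = n, folded lists(4)]
    pf_list_tau_even[where m = m and n = "n + 1", folded lists(6)]
  have "even (length A)" by (simp add: A_def)
  then have "?P (D k # a # A @ [b, Z]) * ?P A + ?P (D k # A @ [b]) * ?P (a # A @ [Z]) =
      ?P (D k # a # A) * ?P (A @ [b, Z]) + ?P (a # A @ [b]) * ?P (D k # A @ [Z])"
    by (rule pf_list_split_even[OF poly_entry_skew[OF skew]])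
  then show ?thesis
    unfolding Pf_Q Pf_tau coeff_E_def coeff_F_def
    \<comment> \<open>The Pfaffians with \<open>Z\<close> on the right start at \<open>m + 1\<close>
      and carry \<open>z^(m+1)\<close>; the factor left after cancelling \<open>z^m\<close> is the
      \<open>z\<close> of the recurrence.\<close>
    by (intro cancel_scaled[where y = "[:0, 1:] ^ m"])
      (use tau_even_nz[of "m + 1" n] tau_odd_nz[of m n] in \<open>simp_all add: algebra_simps\<close>)
qed

text \<open>The block now has odd length, and the products of \<open>pf_list_split_odd\<close> again
  give the four terms in order.\<close>

lemma Q_even_recurrence:
  "Q_even \<mu> \<beta> m (n + 1) + smult (coeff_G \<mu> \<beta> m k n) (Q_odd \<mu> \<beta> m k (int n)) =
     [:0, 1:] * (Q_odd \<mu> \<beta> (m + 1) k (int n) + smult (coeff_H \<mu> \<beta> m k n) (Q_even \<mu> \<beta> (m + 1) n))"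
proof -
  let ?P = "pf_list (poly_entry \<mu> \<beta>)"
  define A where "A = map Idx [m + 1..<m + 1 + 2 * n + 1]"
  define a b where "a = Idx m" and "b = Idx (m + 2 * n + 2)"
  have lists:
    "a # A @ [b, Z] = map Idx [m..<m + 2 * (n + 1) + 1] @ [Z]"
    "D k # A = D k # map Idx [m + 1..<m + 1 + 2 * n + 1]"
    "A @ [b] = map Idx [m + 1..<m + 1 + 2 * (n + 1)]"
    "D k # a # A @ [Z] = D k # map Idx [m..<m + 2 * Suc n] @ [Z]"
    "a # A = map Idx [m..<m + 2 * (n + 1)]"
    "D k # A @ [b, Z] = D k # map Idx [m + 1..<m + 1 + 2 * Suc n] @ [Z]"
    "D k # a # A @ [b] = D k # map Idx [m..<m + 2 * Suc n + 1]"
    "A @ [Z] = map Idx [m + 1..<m + 1 + 2 * n + 1] @ [Z]"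
    by (simp_all add: A_def a_def b_def upt_conv_Cons)
  note Pf_Q =
    pf_list_Q_even[where m = m and n = "n + 1", OF tau_even_nz, folded lists(1)]
    pf_list_Q_odd[where m = m and n = "Suc n", OF tau_odd_nz, folded lists(4)]
    pf_list_Q_odd[where m = "m + 1" and n = "Suc n", OF tau_odd_nz, folded lists(6)]
    pf_list_Q_even[where m = "m + 1" and n = n, OF tau_even_nz, folded lists(8)]
  note Pf_tau =
    pf_list_tau_odd[where k = k and m = "m + 1" and n = n, folded lists(2)]
    pf_list_tau_even[where m = "m + 1" and n = "n + 1", folded lists(3)]
    pf_list_tau_even[where m = m and n = "n + 1", folded lists(5)]
    \<comment> \<open>Both \<open>a\<close> and \<open>b\<close> join the block here, which gives
      index 2n+3, the \<open>tau\<close> in the numerator of \<open>coeff_H\<close>.\<close>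
    pf_list_tau_odd[where k = k and m = m and n = "Suc n", folded lists(7)]
  have "odd (length A)" by (simp add: A_def)
  then have "?P (a # A @ [b, Z]) * ?P (D k # A) + ?P (A @ [b]) * ?P (D k # a # A @ [Z]) =
      ?P (a # A) * ?P (D k # A @ [b, Z]) + ?P (D k # a # A @ [b]) * ?P (A @ [Z])"
    by (rule pf_list_split_odd[OF poly_entry_skew[OF skew]])
  then show ?thesis
    unfolding Pf_Q Pf_tau coeff_G_def coeff_H_def
    by (intro cancel_scaled[where y = "[:0, 1:] ^ m"])
      (use tau_even_nz[of m "n + 1"] tau_odd_nz[of "m + 1" n] in \<open>simp_all add: algebra_simps\<close>)
qed

end

theorem mainTheorem3:
  fixes l :: nat
    and \<mu> :: "nat \<Rightarrow> nat \<Rightarrow> real"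
    and \<beta> :: "nat \<Rightarrow> nat \<Rightarrow> real"
  assumes "l \<ge> 1"
    and "\<And>i j. \<mu> i j = - \<mu> j i"
    and "\<And>m n. tau_even \<mu> \<beta> m n \<noteq> 0"
    and "\<And>m n k. k \<in> {1..l} \<Longrightarrow> tau_odd \<mu> \<beta> m k (int n) \<noteq> 0"
  shows "\<forall>n m. \<forall>k\<in>{1..l}.
     Q_odd \<mu> \<beta> m k (int n) + smult (coeff_E \<mu> \<beta> m k n) (Q_even \<mu> \<beta> m n)
       = [:0, 1:] * (Q_even \<mu> \<beta> (m + 1) n
           + smult (coeff_F \<mu> \<beta> m k n) (Q_odd \<mu> \<beta> (m + 1) k (int n - 1))) \<and>
     Q_even \<mu> \<beta> m (n + 1) + smult (coeff_G \<mu> \<beta> m k n) (Q_odd \<mu> \<beta> m k (int n))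
       = [:0, 1:] * (Q_odd \<mu> \<beta> (m + 1) k (int n)
           + smult (coeff_H \<mu> \<beta> m k n) (Q_even \<mu> \<beta> (m + 1) n))"
proof (intro allI ballI conjI)
  fix n m k assume "k \<in> {1..l}"
  note recs = Q_odd_recurrence[OF assms(2,3) assms(4)[OF this]] Q_even_recurrence[OF assms(2,3) assms(4)[OF this]]
  show "Q_odd \<mu> \<beta> m k (int n) + smult (coeff_E \<mu> \<beta> m k n) (Q_even \<mu> \<beta> m n)
       = [:0, 1:] * (Q_even \<mu> \<beta> (m + 1) n
           + smult (coeff_F \<mu> \<beta> m k n) (Q_odd \<mu> \<beta> (m + 1) k (int n - 1)))"
    by (rule recs(1))
  show "Q_even \<mu> \<beta> m (n + 1) + smult (coeff_G \<mu> \<beta> m k n) (Q_odd \<mu> \<beta> m k (int n))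
       = [:0, 1:] * (Q_odd \<mu> \<beta> (m + 1) k (int n)
           + smult (coeff_H \<mu> \<beta> m k n) (Q_even \<mu> \<beta> (m + 1) n))"
    by (rule recs(2))
qed

end
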